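(* Let $n \geq 1$ be an integer, let $k_1, \dots, k_n$ be non-negative integers, and set $m = k_1 + \cdots + k_n$. For each $1\leq i \leq n$, let $F_i$ be a family of $k_i+2$ convex sets in $\mathbb{R}^{n+m-1}$, and suppose that the families $F_1, \dots, F_n$ satisfy the colorful intersection property, that is, $C_1\cap \cdots \cap C_n\neq \emptyset$ for every choice of $C_1\in F_1, \dots, C_n\in F_n$. Then there exists an index $i \in \{1,\dots,n\}$ such that $F_i$ admits a $k_i$-transversal, that is, there is a $k_i$-dimensional affine flat in $\mathbb{R}^{n+m-1}$ that intersects every member of $F_i$.
   Context: Finite families $F_1, \dots, F_n$ of convex sets in $\mathbb{R}^d$ satisfy the colorful intersection property if $C_1\cap \cdots \cap C_n\neq \emptyset$ for any choice of $C_1\in F_1, \dots, C_n\in F_n$. A $k$-transversal to a family $F$ of convex sets in $\mathbb{R}^d$ is a $k$-dimensional affine flat (affine subspace) of $\mathbb{R}^d$ that intersects every member of $F$. The convex sets are not assumed to be closed or bounded. *)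

theory Defs
  imports "HOL-Analysis.Analysis"
begin

definition colorful_intersection :: "nat \<Rightarrow> (nat \<Rightarrow> 'a set set) \<Rightarrow> bool" where
  "colorful_intersection n F \<longleftrightarrow>
     (\<forall>C. (\<forall>i\<in>{1..n}. C i \<in> F i) \<longrightarrow> (\<Inter>i\<in>{1..n}. C i) \<noteq> {})"

definition transversal :: "nat \<Rightarrow> 'a::euclidean_space set set \<Rightarrow> 'a set \<Rightarrow> bool" where
  "transversal k F L \<longleftrightarrow> affine L \<and> aff_dim L = int k \<and> (\<forall>C\<in>F. L \<inter> C \<noteq> {})"

end

theory Submission
  imports Defs "HOL-Homology.Invariance_of_Domain"
begin

text \<open>
  Choose a point \<open>p J\<close> in each colorful intersection \<open>\<Inter>i. F i (J i)\<close> and extend \<open>p\<close> multilinearly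
  to the product of the simplices on \<open>k i + 2\<close> vertices. By Borsuk--Ulam, in the manner of the
  topological Radon theorem, this map agrees at two points of the product whose \<open>i\<close>-th components
  have disjoint supports for some \<open>i\<close>. Slicing the multilinear sum along \<open>i\<close> turns the coincidence
  into an affine dependence between points of \<open>F i 0, \<dots>, F i (k i + 1)\<close>, so these \<open>k i + 2\<close>
  points lie in a common \<open>k i\<close>-flat.

  Borsuk--Ulam itself comes from the mod 2 degree step for odd maps preserving an equator: an odd
  map \<open>S\<^sup>n \<rightarrow> \<real>\<^sup>n - {0}\<close> is approximated by a polynomial map, and in generic linear coordinates of
  the target it can be rescaled to preserve a full flag of subspheres. Such a map has odd degree,
  but it is not surjective onto \<open>S\<^sup>n\<close>.
\<close>

subsection \<open>The Borsuk--Ulam theorem\<close>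

lemma topspace_nsphere:
  "topspace (nsphere n) = {x. (\<Sum>i\<le>n. (x i)\<^sup>2) = 1 \<and> (\<forall>i>n. x i = 0)}"
  by (simp add: nsphere)

lemma topspace_nsphere_Suc: "topspace (nsphere n) \<subseteq> topspace (nsphere (Suc n))"
  by (auto simp: topspace_nsphere)

lemma topspace_nsphere_mono: "m \<le> n \<Longrightarrow> topspace (nsphere m) \<subseteq> topspace (nsphere n)"
  by (rule lift_Suc_mono_le) (use topspace_nsphere_Suc in auto)

text \<open>On the two-point sphere an odd map is either the identity or the swap, and the swap is a
  reflection, so the degree is 1 or -1.\<close>

lemma odd_Brouwer_degree2_nsphere_0:
  assumes im: "f \<in> topspace (nsphere 0) \<rightarrow> topspace (nsphere 0)"
    and odd: "\<And>x. x \<in> topspace (nsphere 0) \<Longrightarrow> f (\<lambda>i. - x i) = (\<lambda>i. - f x i)"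
  shows "odd (Brouwer_degree2 0 f)"
proof -
  define e where "e = (\<lambda>i::nat. if i = 0 then 1 else 0 :: real)"
  have S0: "x = e \<or> x = (\<lambda>i. - e i)" if "x \<in> topspace (nsphere 0)" for x
  proof -
    have "x 0 = 1 \<or> x 0 = -1" "\<And>i. i > 0 \<Longrightarrow> x i = 0"
      using that by (auto simp: topspace_nsphere power2_eq_1_iff)
    then show ?thesis
      by (auto simp: e_def fun_eq_iff)
  qed
  have e: "e \<in> topspace (nsphere 0)"
    unfolding e_def by (rule in_topspace_nsphere)
  then have "f e \<in> topspace (nsphere 0)"
    using im by blast
  from S0[OF this] show ?thesis
  proof
    assume "f e = e"
    then have "Brouwer_degree2 0 f = Brouwer_degree2 0 id"
      using S0 odd[OF e] by (intro Brouwer_degree2_eq) (metis id_apply)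
    then show ?thesis
      by simp
  next
    assume *: "f e = (\<lambda>i. - e i)"
    have "Brouwer_degree2 0 f = Brouwer_degree2 0 (\<lambda>x i. if i = 0 then - x i else x i)"
    proof (rule Brouwer_degree2_eq)
      fix x assume "x \<in> topspace (nsphere 0)"
      then consider "x = e" | "x = (\<lambda>i. - e i)"
        using S0 by blast
      then show "f x = (\<lambda>i. if i = 0 then - x i else x i)"
        by cases (use * odd[OF e] in \<open>auto simp: e_def\<close>)
    qed
    then show ?thesis
      by (simp add: Brouwer_degree2_reflection)
  qed
qed

text \<open>\<open>Borsuk_odd_mapping_degree_step\<close> compares the degree modulo 2 with that of
  the restriction to the equator. Since the whole flag is preserved, the comparison can be iterated
  down to the two-point sphere.\<close>

lemma odd_Brouwer_degree2_flag:
  assumes cont: "continuous_map (nsphere n) (nsphere n) f"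
    and odd: "\<And>x. x \<in> topspace (nsphere n) \<Longrightarrow> f (\<lambda>i. - x i) = (\<lambda>i. - f x i)"
    and flag: "\<And>j. j < n \<Longrightarrow> f \<in> topspace (nsphere j) \<rightarrow> topspace (nsphere j)"
  shows "odd (Brouwer_degree2 n f)"
  using assms
proof (induction n)
  case 0
  then show ?case
    by (intro odd_Brouwer_degree2_nsphere_0) (auto simp: continuous_map_def)
next
  case (Suc n)
  have "even (Brouwer_degree2 (Suc n) f - Brouwer_degree2 (Suc n - Suc 0) f)"
    using Suc.prems by (intro Borsuk_odd_mapping_degree_step) auto
  moreover have "odd (Brouwer_degree2 n f)"
  proof (rule Suc.IH)
    have eq: "nsphere n = subtopology (nsphere (Suc n)) {x. x (Suc n) = 0}"
      by (simp add: subtopology_nsphere_equator)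
    have "continuous_map (nsphere n) (nsphere (Suc n)) f"
      using Suc.prems(1) unfolding eq by (rule continuous_map_from_subtopology)
    moreover have "f \<in> topspace (nsphere n) \<rightarrow> {x. x (Suc n) = 0}"
      using Suc.prems(3)[of n] by (auto simp: topspace_nsphere Pi_iff)
    ultimately show "continuous_map (nsphere n) (nsphere n) f"
      by (subst (2) eq) (auto simp: continuous_map_in_subtopology)
  next
    fix x assume "x \<in> topspace (nsphere n)"
    then show "f (\<lambda>i. - x i) = (\<lambda>i. - f x i)"
      using topspace_nsphere_Suc Suc.prems(2) by blast
  qed (use Suc.prems in auto)
  ultimately show ?case
    by simp
qed

text \<open>Weighting the \<open>i\<close>-th coordinate by \<open>\<Sum>l\<in>{i..n}. (x l)\<^sup>2\<close>, which vanishes on the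
  smaller spheres of the flag, makes \<open>h\<close> preserve the whole flag.\<close>

lemma no_nondegenerate_odd_flag_map:
  fixes h :: "(nat \<Rightarrow> real) \<Rightarrow> nat \<Rightarrow> real"
  assumes "n \<ge> 1"
    and cont: "\<And>i. i < n \<Longrightarrow> continuous_map (nsphere n) euclideanreal (\<lambda>x. h x i)"
    and odd: "\<And>x i. x \<in> topspace (nsphere n) \<Longrightarrow> i < n \<Longrightarrow> h (\<lambda>l. - x l) i = - h x i"
    and nz: "\<And>x. x \<in> topspace (nsphere n) \<Longrightarrow> \<exists>i<n. h x i \<noteq> 0"
    and nz_flag: "\<And>j x. j < n \<Longrightarrow> x \<in> topspace (nsphere j) \<Longrightarrow> \<exists>i\<le>j. h x i \<noteq> 0"
  shows False
proof -
  define T where "T = (\<lambda>i (x::nat \<Rightarrow> real). \<Sum>l\<in>{i..n}. (x l)\<^sup>2)"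
  define N where "N = (\<lambda>x. sqrt (\<Sum>i<n. (T i x * h x i)\<^sup>2))"
  define f where "f = (\<lambda>x i. if i < n then T i x * h x i / N x else 0)"
  have Tpos: "T i x > 0" if "i \<le> l" "l \<le> n" "x l \<noteq> 0" for i l x
    unfolding T_def using that by (intro sum_pos2[of _ l]) auto
  \<comment> \<open>If \<open>j\<close> is the last index with \<open>x j\<close> nonzero, then
    \<open>x\<close> lies on the \<open>j\<close>-sphere and every weight \<open>T i x\<close> with
    \<open>i \<le> j\<close> is positive. Nondegeneracy on that sphere supplies such an
    \<open>i\<close>, so the weighting creates no zeros.\<close>
  have wit: "\<exists>i<n. T i x * h x i \<noteq> 0" if x: "x \<in> topspace (nsphere n)" for x
  proof -
    have ex: "\<exists>l. l \<le> n \<and> x l \<noteq> 0"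
    proof (rule ccontr)
      assume "\<nexists>l. l \<le> n \<and> x l \<noteq> 0"
      then have "(\<Sum>i\<le>n. (x i)\<^sup>2) = 0"
        by (intro sum.neutral) auto
      with x show False
        by (simp add: topspace_nsphere)
    qed
    define j where "j = (GREATEST l. l \<le> n \<and> x l \<noteq> 0)"
    have j: "j \<le> n" "x j \<noteq> 0"
      using GreatestI_ex_nat[OF ex, of n] by (auto simp: j_def)
    have gt: "x l = 0" if "l > j" for l
    proof (cases "l \<le> n")
      case True
      then show ?thesis
        using Greatest_le_nat[of "\<lambda>l. l \<le> n \<and> x l \<noteq> 0" l n] that by (force simp: j_def)
    qed (use x in \<open>auto simp: topspace_nsphere\<close>)
    have "\<exists>i<n. i \<le> j \<and> h x i \<noteq> 0"
    proof (cases "j < n")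
      case True
      have "(\<Sum>i\<le>j. (x i)\<^sup>2) = (\<Sum>i\<le>n. (x i)\<^sup>2)"
        using j gt by (intro sum.mono_neutral_left) auto
      then have "x \<in> topspace (nsphere j)"
        using x gt by (auto simp: topspace_nsphere)
      from nz_flag[OF True this] show ?thesis
        using True by (meson order_le_less_trans)
    qed (use nz[OF x] in force)
    then show ?thesis
      using Tpos[of _ j x] j by (metis less_irrefl mult_eq_0_iff)
  qed
  have Npos: "N x > 0" if x: "x \<in> topspace (nsphere n)" for x
  proof -
    obtain i where "i < n" "T i x * h x i \<noteq> 0"
      using wit[OF x] by blast
    then have "(\<Sum>i<n. (T i x * h x i)\<^sup>2) > 0"
      by (intro sum_pos2[of _ i]) auto
    then show ?thesis
      by (simp add: N_def)
  qed
  have fsum: "(\<Sum>i<n. (f x i)\<^sup>2) = 1" if x: "x \<in> topspace (nsphere n)" for x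
  proof -
    have "(\<Sum>i<n. (f x i)\<^sup>2) = (\<Sum>i<n. (T i x * h x i)\<^sup>2) / (N x)\<^sup>2"
      unfolding sum_divide_distrib by (intro sum.cong) (auto simp: f_def power_divide)
    also have "(N x)\<^sup>2 = (\<Sum>i<n. (T i x * h x i)\<^sup>2)"
      by (simp add: N_def sum_nonneg)
    finally show ?thesis
      using Npos[OF x] by (simp add: N_def)
  qed
  have fim: "f x \<in> topspace (nsphere j)"
    if j: "j \<le> n" and x: "x \<in> topspace (nsphere j)" for j x
  proof -
    have xn: "x \<in> topspace (nsphere n)"
      using topspace_nsphere_mono[OF j] x by blast
    have "T i x = 0" if "i > j" for i
      unfolding T_def using x that by (intro sum.neutral) (auto simp: topspace_nsphere)
    then have z: "f x i = 0" if "i > j" for i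
      using that by (simp add: f_def)
    have "(\<Sum>i\<le>j. (f x i)\<^sup>2) = (\<Sum>i\<le>n. (f x i)\<^sup>2)"
      using j z by (intro sum.mono_neutral_left) auto
    also have "\<dots> = (\<Sum>i<n. (f x i)\<^sup>2)"
      by (intro sum.mono_neutral_right) (auto simp: f_def)
    finally show ?thesis
      using fsum[OF xn] z by (auto simp: topspace_nsphere)
  qed
  have contT: "continuous_map (nsphere n) euclideanreal (T i)" for i
    unfolding T_def by (intro continuous_intros continuous_map_nsphere_projection) auto
  have contN: "continuous_map (nsphere n) euclideanreal N"
  proof -
    have "continuous_map (nsphere n) euclideanreal (\<lambda>x. \<Sum>i<n. (T i x * h x i)\<^sup>2)"
      by (intro continuous_intros contT cont) auto
    moreover have "continuous_map euclideanreal euclideanreal sqrt"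
      by (simp add: continuous_on_real_sqrt)
    ultimately show ?thesis
      unfolding N_def by (rule continuous_map_compose[unfolded o_def])
  qed
  have contf: "continuous_map (nsphere n) (nsphere n) f"
  proof -
    have "continuous_map (nsphere n) euclideanreal (\<lambda>x. f x i)" for i
    proof (cases "i < n")
      case True
      have "continuous_map (nsphere n) euclideanreal (\<lambda>x. T i x * h x i / N x)"
        using Npos by (intro continuous_intros contT contN cont[OF True]) force
      then show ?thesis
        using True by (simp add: f_def)
    qed (simp add: f_def)
    then have "continuous_map (nsphere n) (powertop_real UNIV) f"
      by (simp add: continuous_map_componentwise_UNIV)
    then show ?thesis
      unfolding nsphere[of n] continuous_map_in_subtopology
      using fim[of n] by (auto simp: nsphere continuous_map_from_subtopology Pi_iff)
  qed
  have Tuminus: "T i (\<lambda>l. - x l) = T i x" for i x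
    by (simp add: T_def)
  have "odd (Brouwer_degree2 n f)"
  proof (rule odd_Brouwer_degree2_flag[OF contf])
    fix x assume x: "x \<in> topspace (nsphere n)"
    have "N (\<lambda>l. - x l) = N x"
      unfolding N_def using odd[OF x] by (simp add: Tuminus)
    then show "f (\<lambda>i. - x i) = (\<lambda>i. - f x i)"
      using odd[OF x] by (auto simp: f_def Tuminus fun_eq_iff)
  qed (use fim in auto)
  \<comment> \<open>The last coordinate of \<open>f\<close> is constantly 0, so the north pole is
    missed; degree 0 contradicts oddness of the degree.\<close>
  moreover have "Brouwer_degree2 n f = 0"
  proof (rule Brouwer_degree2_nonsurjective[OF contf])
    have "(\<lambda>i. if i = n then 1 else 0) \<in> topspace (nsphere n)"
      by (auto simp: topspace_nsphere if_distrib[where f = "\<lambda>x. x^2"] cong: if_cong)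
    moreover have "f x n = 0" for x
      by (simp add: f_def)
    ultimately show "f ` topspace (nsphere n) \<noteq> topspace (nsphere n)"
      by (smt (verit, best) image_iff)
  qed
  ultimately show False
    by simp
qed

section \<open>Generic directions and flags for odd polynomial maps\<close>

lemma sum_inner_Basis_enum:
  fixes c :: "nat \<Rightarrow> 'a::euclidean_space"
  assumes c: "bij_betw c I Basis"
  shows "(\<Sum>i\<in>I. (x \<bullet> c i) *\<^sub>R c i) = x"
proof -
  have "(\<Sum>i\<in>I. (x \<bullet> c i) *\<^sub>R c i) = (\<Sum>b\<in>Basis. (x \<bullet> b) *\<^sub>R b)"
    by (rule sum.reindex_bij_betw[OF c])
  then show ?thesis
    by (simp add: euclidean_representation)
qed

lemma inner_Basis_enum:
  fixes c :: "nat \<Rightarrow> 'a::euclidean_space"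
  assumes c: "bij_betw c I Basis" and "i \<in> I" "k \<in> I"
  shows "c i \<bullet> c k = (if i = k then 1 else 0)"
proof -
  have "c i \<in> Basis" "c k \<in> Basis"
    using assms bij_betwE by auto
  moreover have "c i = c k \<longleftrightarrow> i = k"
    using assms by (meson bij_betw_imp_inj_on inj_on_eq_iff)
  ultimately show ?thesis
    by (simp add: inner_Basis)
qed

lemma sum_inner_Basis_coord:
  fixes c :: "nat \<Rightarrow> 'a::euclidean_space"
  assumes c: "bij_betw c I Basis" and J: "J \<subseteq> I" "finite J" and "k \<in> I"
  shows "(\<Sum>i\<in>J. g i *\<^sub>R c i) \<bullet> c k = (if k \<in> J then g k else 0)"
proof -
  have "(\<Sum>i\<in>J. g i *\<^sub>R c i) \<bullet> c k = (\<Sum>i\<in>J. g i * (if i = k then 1 else 0))"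
    unfolding inner_sum_left inner_scaleR_left
    using assms by (intro sum.cong refl) (subst inner_Basis_enum[OF c], auto)
  also have "\<dots> = (if k \<in> J then g k else 0)"
    using J(2) by (simp add: if_distrib[of "(*) _"] cong: if_cong)
  finally show ?thesis .
qed

text \<open>The coefficients of a linear combination are stored as coordinates of a single vector
  \<open>y\<close>, so that they can become part of the argument of a differentiable map. The
  \<open>p i\<close> need not be distinct.\<close>

lemma span_image_subset_range_sum:
  fixes p :: "nat \<Rightarrow> 'b::real_vector" and c :: "nat \<Rightarrow> 'a::euclidean_space"
  assumes c: "bij_betw c I Basis" and J: "J \<subseteq> I" "finite J"
    and w: "w \<in> span (p ` J)"
  obtains y where "w = (\<Sum>i\<in>J. (y \<bullet> c i) *\<^sub>R p i)"
proof -
  define l where "l = (\<lambda>y. \<Sum>i\<in>J. (y \<bullet> c i) *\<^sub>R p i)"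
  have "linear l"
    by (rule linearI)
      (simp_all add: l_def inner_add_left scaleR_add_left sum.distrib scaleR_right.sum)
  then have "subspace (range l)"
    by (rule linear_subspace_image) simp
  moreover have "p ` J \<subseteq> range l"
  proof
    fix u assume "u \<in> p ` J"
    then obtain k where k: "k \<in> J" "u = p k"
      by blast
    have "l (c k) = (\<Sum>i\<in>J. (if k = i then 1 else 0) *\<^sub>R p i)"
      unfolding l_def using k(1) J
      by (intro sum.cong refl) (subst inner_Basis_enum[OF c], auto)
    also have "\<dots> = p k"
      using k(1) J(2) by (simp add: if_distrib[of "\<lambda>t. t *\<^sub>R _"] cong: if_cong)
    finally show "u \<in> range l"
      using k(2) by (metis rangeI)
  qed
  ultimately have "span (p ` J) \<subseteq> range l"
    by (rule span_minimal[rotated])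
  then show ?thesis
    using w that unfolding l_def by blast
qed

text \<open>The cone over the sphere \<open>{x. norm x = 1 \<and> (\<forall>i\<in>{r..n}. x \<bullet> a i = 0)}\<close> has dimension \<open>r\<close>,
  so its image under the odd map \<open>q\<close> together with \<open>n - 1 - r\<close> further directions
  cannot fill the \<open>n\<close>-dimensional target.\<close>

lemma generic_direction:
  fixes q :: "'a::euclidean_space \<Rightarrow> 'b::euclidean_space"
  assumes q: "polynomial_function q" and odd: "\<And>x. q (- x) = - q x"
    and a: "bij_betw a {..n} (Basis :: 'a set)" and c: "bij_betw c {..<n} (Basis :: 'b set)"
    and r: "r < n"
    and nz: "\<And>x. norm x = 1 \<Longrightarrow> (\<forall>i\<in>{r..n}. x \<bullet> a i = 0) \<Longrightarrow> q x \<notin> span (p ` {Suc r..<n})"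
  obtains u where "u \<notin> span (p ` {Suc r..<n})"
    "\<And>x. norm x = 1 \<Longrightarrow> (\<forall>i\<in>{r..n}. x \<bullet> a i = 0) \<Longrightarrow> q x \<notin> span (insert u (p ` {Suc r..<n}))"
proof -
  let ?W = "span (p ` {Suc r..<n})"
  define \<pi> :: "'b \<Rightarrow> 'a" where "\<pi> = (\<lambda>y. \<Sum>i<r. (y \<bullet> c i) *\<^sub>R a i)"
  \<comment> \<open>The first summand is the positively homogeneous extension of \<open>q\<close>
    from the small sphere, parametrized by the coordinates below \<open>r\<close>; the second sweeps
    out the span of the later directions.\<close>
  define \<psi> where "\<psi> = (\<lambda>y. norm (\<pi> y) *\<^sub>R q (inverse (norm (\<pi> y)) *\<^sub>R \<pi> y)
     + (\<Sum>i\<in>{Suc r..<n}. (y \<bullet> c i) *\<^sub>R p i))"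
  \<comment> \<open>Coordinate \<open>r\<close> enters neither summand of \<open>\<psi>\<close>, so
    fixing it at 0 loses nothing and puts \<open>D\<close> into a hyperplane. Zeros of
    \<open>\<pi>\<close> are removed because the norm is not differentiable at 0.\<close>
  define D where "D = {y. c r \<bullet> y = 0} \<inter> {y. \<pi> y \<noteq> 0}"
  have "linear \<pi>"
    by (rule linearI)
      (simp_all add: \<pi>_def inner_add_left scaleR_add_left sum.distrib scaleR_right.sum)
  then have d\<pi>: "\<pi> differentiable (at y within D)" for y
    by (rule linear_imp_differentiable)
  have dn: "(\<lambda>y. norm (\<pi> y)) differentiable (at y within D)" if "y \<in> D" for y
    using that by (intro differentiable_compose[OF differentiable_norm_at d\<pi>]) (auto simp: D_def)
  have "linear (\<lambda>y. \<Sum>i\<in>{Suc r..<n}. (y \<bullet> c i) *\<^sub>R p i)"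
    by (rule linearI)
      (simp_all add: inner_add_left scaleR_add_left sum.distrib scaleR_right.sum)
  note dl = linear_imp_differentiable[OF this]
  have "\<psi> differentiable_on D"
    unfolding differentiable_on_def \<psi>_def
  proof (intro ballI differentiable_add differentiable_scaleR dl dn)
    fix y assume y: "y \<in> D"
    show "(\<lambda>y. q (inverse (norm (\<pi> y)) *\<^sub>R \<pi> y)) differentiable at y within D"
      using y by (intro differentiable_compose[OF differentiable_at_polynomial_function[OF q]]
          differentiable_scaleR differentiable_inverse dn d\<pi>) (auto simp: D_def)
  qed
  moreover have "negligible D"
  proof (rule negligible_subset)
    have "c r \<in> Basis"
      using c r bij_betwE by blast
    then show "negligible {y. c r \<bullet> y = 0}"
      by (intro negligible_hyperplane) auto
  qed (auto simp: D_def)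
  ultimately have "negligible (\<psi> ` D)"
    by (intro negligible_differentiable_image_negligible) auto
  moreover have "negligible ?W"
  proof (rule negligible_lowdim)
    have "dim ?W \<le> card (p ` {Suc r..<n})"
      by (rule dim_le_card) auto
    also have "\<dots> \<le> n - Suc r"
      using card_image_le[of "{Suc r..<n}" p] by simp
    also have "\<dots> < DIM('b)"
      using r bij_betw_same_card[OF c] by simp
    finally show "dim ?W < DIM('b)" .
  qed
  ultimately have "negligible (\<psi> ` D \<union> ?W)"
    by simp
  then obtain u where u: "u \<notin> \<psi> ` D" "u \<notin> ?W"
    by (metis UNIV_eq_I UnCI non_negligible_UNIV)
  show thesis
  proof (rule that[OF u(2)])
    fix x assume x: "norm x = 1" "\<forall>i\<in>{r..n}. x \<bullet> a i = 0"
    show "q x \<notin> span (insert u (p ` {Suc r..<n}))"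
    proof
      assume "q x \<in> span (insert u (p ` {Suc r..<n}))"
      then obtain s where s: "q x - s *\<^sub>R u \<in> ?W"
        by (auto simp: span_breakdown_eq)
      have "s \<noteq> 0"
        using s nz[OF x] by auto
      \<comment> \<open>The cone contains only nonnegative multiples. For negative \<open>s\<close>,
        oddness of \<open>q\<close> allows a passage to the antipode, which turns the multiplier
        into the absolute value of \<open>s\<close>.\<close>
      define x' where "x' = sgn s *\<^sub>R x"
      have qx': "q x' = sgn s *\<^sub>R q x"
        using \<open>s \<noteq> 0\<close> odd by (auto simp: x'_def sgn_if)
      have "(- inverse s) *\<^sub>R (q x - s *\<^sub>R u) \<in> ?W"
        by (rule span_scale[OF s])
      moreover have "(- inverse s) *\<^sub>R (q x - s *\<^sub>R u) = u - inverse \<bar>s\<bar> *\<^sub>R q x'"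
        using \<open>s \<noteq> 0\<close> by (auto simp: qx' algebra_simps sgn_if abs_if)
      ultimately have w: "u - inverse \<bar>s\<bar> *\<^sub>R q x' \<in> ?W"
        by simp
      have sub: "{Suc r..<n} \<subseteq> {..<n}" "finite {Suc r..<n}"
        by auto
      obtain z where z: "u - inverse \<bar>s\<bar> *\<^sub>R q x' = (\<Sum>i\<in>{Suc r..<n}. (z \<bullet> c i) *\<^sub>R p i)"
        by (rule span_image_subset_range_sum[OF c sub w])
      \<comment> \<open>These are the coordinates of a preimage of \<open>u\<close> in
        \<open>D\<close>: a scaled copy of \<open>x'\<close> below \<open>r\<close>, and the span
        coefficients above \<open>r\<close>.\<close>
      define g where "g = (\<lambda>i. if i < r then inverse \<bar>s\<bar> * (x' \<bullet> a i) else z \<bullet> c i)"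
      define y where "y = (\<Sum>i\<in>{..<n} - {r}. g i *\<^sub>R c i)"
      have yc: "y \<bullet> c i = (if i = r then 0 else g i)" if "i < n" for i
        unfolding y_def using that by (subst sum_inner_Basis_coord[OF c]) auto
      have "x' = (\<Sum>i\<le>n. (x' \<bullet> a i) *\<^sub>R a i)"
        by (simp add: sum_inner_Basis_enum[OF a])
      also have "\<dots> = (\<Sum>i<r. (x' \<bullet> a i) *\<^sub>R a i)"
        using x(2) r by (intro sum.mono_neutral_right) (auto simp: x'_def)
      finally have x'_eq: "x' = (\<Sum>i<r. (x' \<bullet> a i) *\<^sub>R a i)" .
      have "\<pi> y = (\<Sum>i<r. inverse \<bar>s\<bar> *\<^sub>R (x' \<bullet> a i) *\<^sub>R a i)"
        unfolding \<pi>_def using r by (intro sum.cong) (auto simp: yc g_def)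
      also have "\<dots> = inverse \<bar>s\<bar> *\<^sub>R x'"
        using x'_eq by (metis scaleR_right.sum)
      finally have \<pi>y: "\<pi> y = inverse \<bar>s\<bar> *\<^sub>R x'" .
      have nx': "norm x' = 1"
        using x(1) \<open>s \<noteq> 0\<close> by (simp add: x'_def sgn_if)
      have n\<pi>: "norm (\<pi> y) = inverse \<bar>s\<bar>"
        by (simp add: \<pi>y nx')
      have "(\<Sum>i\<in>{Suc r..<n}. (y \<bullet> c i) *\<^sub>R p i) = (\<Sum>i\<in>{Suc r..<n}. (z \<bullet> c i) *\<^sub>R p i)"
        by (intro sum.cong) (auto simp: yc g_def)
      then have "\<psi> y = inverse \<bar>s\<bar> *\<^sub>R q x' + (\<Sum>i\<in>{Suc r..<n}. (z \<bullet> c i) *\<^sub>R p i)"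
        unfolding \<psi>_def n\<pi> using \<open>s \<noteq> 0\<close> by (simp add: \<pi>y)
      also have "\<dots> = u"
        using z by (simp add: algebra_simps)
      finally have "\<psi> y = u" .
      moreover have "y \<in> D"
        using yc[OF r] n\<pi> \<open>s \<noteq> 0\<close> by (auto simp: D_def inner_commute)
      ultimately show False
        using u(1) by blast
    qed
  qed
qed

text \<open>The directions are chosen from \<open>p (n - 1)\<close> down to \<open>p 0\<close>, each
  by \<open>generic_direction\<close>. The first clause makes them a basis; the second is the
  nondegeneracy on smaller spheres required by the flag argument. The start \<open>j = n\<close>
  only says that \<open>q\<close> has no zero, as the span is then trivial.\<close>

lemma generic_flag:
  fixes q :: "'a::euclidean_space \<Rightarrow> 'b::euclidean_space"
  assumes q: "polynomial_function q" and odd: "\<And>x. q (- x) = - q x"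
    and a: "bij_betw a {..n} (Basis :: 'a set)" and c: "bij_betw c {..<n} (Basis :: 'b set)"
    and nz: "\<And>x. norm x = 1 \<Longrightarrow> q x \<noteq> 0"
  shows "\<exists>p. (\<forall>j<n. p j \<notin> span (p ` {Suc j..<n})) \<and>
    (\<forall>j\<le>n. \<forall>x. norm x = 1 \<longrightarrow> (\<forall>i\<in>{j..n}. x \<bullet> a i = 0) \<longrightarrow> q x \<notin> span (p ` {j..<n}))"
proof -
  have "\<exists>p. (\<forall>j\<in>{k..<n}. p j \<notin> span (p ` {Suc j..<n})) \<and>
    (\<forall>j\<in>{k..n}. \<forall>x. norm x = 1 \<longrightarrow> (\<forall>i\<in>{j..n}. x \<bullet> a i = 0) \<longrightarrow> q x \<notin> span (p ` {j..<n}))"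
    if "k \<le> n" for k
    using that
  proof (induction k rule: inc_induct)
    case base
    then show ?case
      using nz by auto
  next
    case (step r)
    then obtain p where p: "\<And>j. j \<in> {Suc r..<n} \<Longrightarrow> p j \<notin> span (p ` {Suc j..<n})"
      "\<And>j x. j \<in> {Suc r..n} \<Longrightarrow> norm x = 1 \<Longrightarrow> (\<forall>i\<in>{j..n}. x \<bullet> a i = 0) \<Longrightarrow> q x \<notin> span (p ` {j..<n})"
      by blast
    obtain u where u: "u \<notin> span (p ` {Suc r..<n})"
      "\<And>x. norm x = 1 \<Longrightarrow> (\<forall>i\<in>{r..n}. x \<bullet> a i = 0) \<Longrightarrow> q x \<notin> span (insert u (p ` {Suc r..<n}))"
    proof (rule generic_direction[OF q odd a c \<open>r < n\<close>, of p])
      fix x assume "norm x = 1" "\<forall>i\<in>{r..n}. x \<bullet> a i = 0"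
      then show "q x \<notin> span (p ` {Suc r..<n})"
        using step.hyps by (intro p(2)) auto
    qed (rule that)
    define p' where "p' = p(r := u)"
    have im: "p' ` {j..<n} = p ` {j..<n}" if "j > r" for j
      unfolding p'_def using that by (intro image_cong) auto
    have "{r..<n} = insert r {Suc r..<n}"
      using \<open>r < n\<close> by auto
    then have "p' ` {r..<n} = insert (p' r) (p' ` {Suc r..<n})"
      by simp
    then have im': "p' ` {r..<n} = insert u (p ` {Suc r..<n})"
      using im[of "Suc r"] unfolding p'_def by simp
    show ?case
    proof (intro exI[of _ p'] conjI ballI allI impI)
      fix j assume "j \<in> {r..<n}"
      then show "p' j \<notin> span (p' ` {Suc j..<n})"
        using u(1) p(1)[of j] by (cases "j = r") (auto simp: im, auto simp: p'_def)
    next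
      fix j x assume "j \<in> {r..n}" "norm x = 1" "\<forall>i\<in>{j..n}. x \<bullet> a i = 0"
      then show "q x \<notin> span (p' ` {j..<n})"
        using u(2)[of x] p(2)[of j x] by (cases "j = r") (auto simp: im im')
    qed
  qed
  from this[of 0] show ?thesis
    by (simp only: le0 simp_thms atLeast0LessThan atLeast0AtMost Ball_def lessThan_iff atMost_iff)
qed

section \<open>Borsuk-Ulam for polynomial, continuous and subspace-valued maps\<close>

text \<open>In target coordinates with respect to a generic flag basis \<open>p\<close>, avoiding
  the span of the later \<open>p i\<close> means that one of the earlier coordinates is nonzero. A
  zero-free \<open>q\<close> would thus yield a map excluded by
  \<open>no_nondegenerate_odd_flag_map\<close>.\<close>

lemma Borsuk_Ulam_polynomial:
  fixes q :: "'a::euclidean_space \<Rightarrow> 'b::euclidean_space"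
  assumes q: "polynomial_function q" and odd: "\<And>x. q (- x) = - q x"
    and dim: "DIM('a) = Suc DIM('b)"
  shows "\<exists>x. norm x = 1 \<and> q x = 0"
proof (rule ccontr)
  assume "\<nexists>x. norm x = 1 \<and> q x = 0"
  then have nz: "\<And>x. norm x = 1 \<Longrightarrow> q x \<noteq> 0"
    by blast
  define n where "n = DIM('b)"
  have "n \<ge> 1"
    by (simp add: n_def Suc_le_eq)
  obtain c where "bij_betw c {0..<n} (Basis :: 'b set)"
    unfolding n_def using ex_bij_betw_nat_finite[OF finite_Basis] by blast
  then have c: "bij_betw c {..<n} Basis"
    by (simp add: atLeast0LessThan)
  obtain a where "bij_betw a {0..<DIM('a)} (Basis :: 'a set)"
    using ex_bij_betw_nat_finite[OF finite_Basis] by blast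
  then have a: "bij_betw a {..n} Basis"
    by (simp add: dim n_def atLeast0LessThan lessThan_Suc_atMost)
  obtain p where p: "\<And>j. j < n \<Longrightarrow> p j \<notin> span (p ` {Suc j..<n})"
    "\<And>j x. j \<le> n \<Longrightarrow> norm x = 1 \<Longrightarrow> (\<forall>i\<in>{j..n}. x \<bullet> a i = 0) \<Longrightarrow> q x \<notin> span (p ` {j..<n})"
    using generic_flag[OF q odd a c nz] by blast
  have ind: "independent (p ` {k..<n}) \<and> inj_on p {k..<n}" if "k \<le> n" for k
    using that
  proof (induction k rule: inc_induct)
    case (step r)
    have "{r..<n} = insert r {Suc r..<n}"
      using \<open>r < n\<close> by auto
    then show ?case
      using step.IH p(1)[OF \<open>r < n\<close>] span_base[of "p r" "p ` {Suc r..<n}"]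
      by (auto simp: independent_insertI)
  qed (simp add: independent_empty)
  \<comment> \<open>The linear map \<open>L\<close> extending \<open>c'\<close> sends each
    \<open>p i\<close> to the orthonormal vector \<open>c i\<close>, so inner products with
    \<open>c i\<close> read off coordinates in the basis \<open>p\<close>.\<close>
  define c' where "c' = c \<circ> the_inv_into {0..<n} p"
  obtain L where L: "linear L" "\<And>v. v \<in> p ` {0..<n} \<Longrightarrow> L v = c' v"
    using linear_independent_extend[of "p ` {0..<n}" c'] ind[of 0] by auto
  have Lp: "L (p i) = c i" if "i < n" for i
    using that ind[of 0] L(2)[of "p i"] by (simp add: c'_def the_inv_into_f_f)
  have span_p: "span (p ` {0..<n}) = UNIV"
  proof (rule card_ge_dim_independent[THEN top.extremum_uniqueI])
    show "dim (UNIV :: 'b set) \<le> card (p ` {0..<n})"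
      using ind[of 0] by (simp add: card_image n_def)
  qed (use ind[of 0] in auto)
  have Lnz: "\<exists>i<j. L y \<bullet> c i \<noteq> 0" if "j \<le> n" "y \<notin> span (p ` {j..<n})" for j y
  proof (rule ccontr)
    assume H: "\<not> (\<exists>i<j. L y \<bullet> c i \<noteq> 0)"
    obtain z where z: "y = (\<Sum>i\<in>{0..<n}. (z \<bullet> c i) *\<^sub>R p i)"
    proof (rule span_image_subset_range_sum[OF c])
      show "y \<in> span (p ` {0..<n})"
        by (simp add: span_p)
    qed auto
    have "L y = (\<Sum>i\<in>{0..<n}. (z \<bullet> c i) *\<^sub>R c i)"
      unfolding z linear_sum[OF L(1)] linear_scale[OF L(1)] by (intro sum.cong) (auto simp: Lp)
    then have "L y \<bullet> c i = z \<bullet> c i" if "i < n" for i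
      using that by (subst \<open>L y = _\<close>, subst sum_inner_Basis_coord[OF c]) auto
    then have "y = (\<Sum>i\<in>{j..<n}. (z \<bullet> c i) *\<^sub>R p i)"
      using H \<open>j \<le> n\<close> by (subst z, intro sum.mono_neutral_right) auto
    also have "\<dots> \<in> span (p ` {j..<n})"
      by (intro span_sum span_scale span_base) auto
    finally show False
      using that by blast
  qed
  define \<Phi> where "\<Phi> = (\<lambda>x::nat \<Rightarrow> real. \<Sum>i\<le>n. x i *\<^sub>R a i)"
  have \<Phi>a: "\<Phi> x \<bullet> a i = x i" if "i \<le> n" for x i
    using that by (simp add: \<Phi>_def sum_inner_Basis_coord[OF a])
  have norm\<Phi>: "norm (\<Phi> x) = 1" if x: "x \<in> topspace (nsphere n)" for x
  proof -
    have "(norm (\<Phi> x))\<^sup>2 = \<Phi> x \<bullet> (\<Sum>i\<le>n. x i *\<^sub>R a i)"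
      by (simp add: power2_norm_eq_inner \<Phi>_def)
    also have "\<dots> = (\<Sum>i\<le>n. (x i)\<^sup>2)"
      by (simp add: inner_sum_right \<Phi>a power2_eq_square)
    finally show ?thesis
      using x by (auto simp: topspace_nsphere power2_eq_1_iff) (smt (verit) norm_ge_zero)
  qed
  show False
  proof (rule no_nondegenerate_odd_flag_map[OF \<open>n \<ge> 1\<close>])
    fix i assume "i < n"
    have "continuous_map (nsphere n) euclidean (\<lambda>x. x i *\<^sub>R a i)" for i
    proof -
      have "continuous_map euclideanreal euclidean (\<lambda>t. t *\<^sub>R a i)"
        by (auto intro!: continuous_intros)
      then show ?thesis
        by (rule continuous_map_compose[OF continuous_map_nsphere_projection, unfolded o_def])
    qed
    then have "continuous_map (nsphere n) euclidean \<Phi>"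
      unfolding \<Phi>_def by (intro continuous_map_sum) auto
    moreover have "continuous_map euclidean euclidean (\<lambda>v. L (q v) \<bullet> c i)"
      unfolding continuous_map_iff_continuous2
      by (intro continuous_intros linear_continuous_on_compose[OF _ L(1)]
          continuous_on_polymonial_function q)
    ultimately show "continuous_map (nsphere n) euclideanreal (\<lambda>x. L (q (\<Phi> x)) \<bullet> c i)"
      using continuous_map_compose[unfolded o_def] by blast
  next
    fix x :: "nat \<Rightarrow> real" and i
    have "\<Phi> (\<lambda>l. - x l) = - \<Phi> x"
      by (simp add: \<Phi>_def sum_negf)
    then show "L (q (\<Phi> (\<lambda>l. - x l))) \<bullet> c i = - (L (q (\<Phi> x)) \<bullet> c i)"
      by (simp add: odd linear_neg[OF L(1)])
  next
    fix x assume "x \<in> topspace (nsphere n)"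
    then show "\<exists>i<n. L (q (\<Phi> x)) \<bullet> c i \<noteq> 0"
      using nz norm\<Phi> Lnz[of n "q (\<Phi> x)"] by auto
  next
    fix j x assume j: "j < n" and x: "x \<in> topspace (nsphere j)"
    then have "norm (\<Phi> x) = 1"
      using topspace_nsphere_mono[of j n] norm\<Phi> by auto
    moreover have "\<forall>i\<in>{Suc j..n}. \<Phi> x \<bullet> a i = 0"
      using x by (auto simp: \<Phi>a topspace_nsphere)
    ultimately show "\<exists>i\<le>j. L (q (\<Phi> x)) \<bullet> c i \<noteq> 0"
      using Lnz[of "Suc j"] p(2)[of "Suc j"] j by (meson Suc_leI less_Suc_eq_le)
  qed
qed

text \<open>By compactness a zero-free \<open>g\<close> has norm at least some \<open>e > 0\<close>.
  The odd part of a polynomial approximation within \<open>e\<close> has a zero, where the norm of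
  \<open>g\<close> would be below \<open>e\<close>.\<close>

theorem Borsuk_Ulam_odd:
  fixes g :: "'a::euclidean_space \<Rightarrow> 'b::euclidean_space"
  assumes dim: "DIM('a) = Suc DIM('b)"
    and cont: "continuous_on (sphere 0 1) g"
    and odd: "\<And>x. norm x = 1 \<Longrightarrow> g (- x) = - g x"
  obtains x where "norm x = 1" "g x = 0"
proof (rule ccontr)
  assume "\<not> thesis"
  then have nz: "g x \<noteq> 0" if "norm x = 1" for x
    using that \<open>\<And>x. norm x = 1 \<Longrightarrow> g x = 0 \<Longrightarrow> thesis\<close> by blast
  have "compact (g ` sphere 0 1)"
    by (intro compact_continuous_image cont compact_sphere)
  then have "closed (g ` sphere 0 1)"
    by (rule compact_imp_closed)
  moreover have "0 \<notin> g ` sphere 0 1"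
    using nz by auto
  ultimately obtain e where e: "e > 0" "\<forall>y \<in> g ` sphere 0 1. e \<le> dist 0 y"
    using separate_point_closed by metis
  obtain s where s: "polynomial_function s" "\<And>x. x \<in> sphere 0 1 \<Longrightarrow> norm (g x - s x) < e"
    using Stone_Weierstrass_polynomial_function[OF compact_sphere cont e(1)] by blast
  define q where "q = (\<lambda>x. (1/2) *\<^sub>R (s x - s (- x)))"
  have "polynomial_function (s \<circ> uminus)"
    by (rule polynomial_function_compose[OF polynomial_function_minus[OF polynomial_function_id] s(1)])
  then have "polynomial_function q"
    unfolding q_def using s(1)
    by (intro polynomial_function_cmul polynomial_function_diff) (auto simp: o_def)
  then obtain x where x: "norm x = 1" "q x = 0"
    using Borsuk_Ulam_polynomial[of q] dim by (auto simp: q_def algebra_simps)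
  have "2 *\<^sub>R g x = (g x - s x) - (g (- x) - s (- x))"
    using x odd[OF x(1)] by (simp add: q_def scaleR_2)
  then have "norm (2 *\<^sub>R g x) \<le> norm (g x - s x) + norm (g (- x) - s (- x))"
    by (metis norm_triangle_ineq4)
  also have "\<dots> < e + e"
    using s(2)[of x] s(2)[of "- x"] x(1) by (intro add_strict_mono) auto
  finally have "norm (g x) < e"
    by simp
  moreover have "e \<le> norm (g x)"
    using e(2) x(1) by simp
  ultimately show False
    by simp
qed

text \<open>No type has a dimension tied to \<open>dim V\<close>, so \<open>g\<close> is padded to a
  map from \<open>'a \<times> real\<close> to \<open>'a\<close> by adding the component orthogonal
  to \<open>V\<close>. As \<open>g\<close> takes values in \<open>V\<close>, a zero of the padded
  map makes both parts vanish.\<close>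

theorem Borsuk_Ulam_coordinates:
  fixes V :: "'a::euclidean_space set" and g :: "('i \<Rightarrow> real) \<Rightarrow> 'a"
  assumes V: "subspace V" and I: "finite I" "card I = Suc (dim V)"
    and cont: "continuous_on UNIV g" and im: "\<And>x. g x \<in> V"
    and odd: "\<And>x. g (\<lambda>i. - x i) = - g x"
  obtains x where "(\<Sum>i\<in>I. (x i)\<^sup>2) = 1" "g x = 0"
proof -
  obtain B where B: "pairwise orthogonal B" "\<And>b. b \<in> B \<Longrightarrow> norm b = 1"
    "independent B" "card B = dim V" "span B = V"
    using orthonormal_basis_subspace[OF V] by metis
  have finB: "finite B"
    using B(3) independent_imp_finite by blast
  have bb: "b \<bullet> b' = (if b = b' then 1 else 0)" if "b \<in> B" "b' \<in> B" for b b'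
    using that B(1,2) by (auto simp: pairwise_def orthogonal_def norm_eq_1)
  obtain i0 I' where I': "I = insert i0 I'" "i0 \<notin> I'"
    using I(2) by (metis card_Suc_eq)
  then have finI': "finite I'" and "card I' = card B"
    using I B(4) by auto
  then obtain h where h: "bij_betw h I' B"
    using finB finite_same_card_bij by blast
  \<comment> \<open>The sphere coordinates are those along an orthonormal basis of \<open>V\<close>,
    indexed by \<open>I'\<close>, and the extra real one at \<open>i0\<close>.\<close>
  define X :: "'a \<times> real \<Rightarrow> 'i \<Rightarrow> real" where
    "X = (\<lambda>w i. if i = i0 then snd w else fst w \<bullet> h i)"
  define \<pi> :: "'a \<Rightarrow> 'a" where "\<pi> = (\<lambda>y. \<Sum>b\<in>B. (y \<bullet> b) *\<^sub>R b)"
  define G where "G = (\<lambda>w. g (X w) + (fst w - \<pi> (fst w)))"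
  have "continuous_on UNIV (\<lambda>w. X w i)" for i
    unfolding X_def by (cases "i = i0") (auto intro!: continuous_intros)
  then have "continuous_on UNIV X"
    by (intro continuous_on_coordinatewise_then_product)
  then have contX: "continuous_on UNIV (\<lambda>w. g (X w))"
    by (rule continuous_on_compose2[OF cont]) auto
  have "continuous_on UNIV G"
    unfolding G_def \<pi>_def by (intro continuous_intros contX)
  then have contG: "continuous_on (sphere 0 1) G"
    by (rule continuous_on_subset) auto
  have "G (- w) = - G w" for w
  proof -
    have "X (- w) = (\<lambda>i. - X w i)"
      by (auto simp: X_def)
    then show ?thesis
      by (simp add: G_def odd \<pi>_def sum_negf)
  qed
  moreover have "DIM('a \<times> real) = Suc DIM('a)"
    by simp
  ultimately obtain w where w: "norm w = 1" "G w = 0"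
    using Borsuk_Ulam_odd[OF _ contG] by blast
  obtain y r where yr: "w = (y, r)"
    by fastforce
  have \<pi>b: "\<pi> y \<bullet> b = y \<bullet> b" if "b \<in> B" for b
  proof -
    have "\<pi> y \<bullet> b = (\<Sum>b'\<in>B. if b' = b then y \<bullet> b' else 0)"
      unfolding \<pi>_def inner_sum_left using that by (intro sum.cong) (auto simp: bb)
    then show ?thesis
      using finB that by simp
  qed
  have "orthogonal (y - \<pi> y) v" if "v \<in> V" for v
    using that unfolding B(5)[symmetric]
    by (rule orthogonal_to_span) (simp add: orthogonal_def inner_diff_left \<pi>b)
  then have "(y - \<pi> y) \<bullet> g (X w) = 0"
    using im by (simp add: orthogonal_def)
  moreover have g: "g (X w) = - (y - \<pi> y)"
    using w(2) by (simp add: G_def yr add_eq_0_iff2)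
  ultimately have "(y - \<pi> y) \<bullet> (y - \<pi> y) = 0"
    by (metis inner_minus_right neg_equal_0_iff_equal)
  then have y: "y = \<pi> y"
    by simp
  have "(norm y)\<^sup>2 = y \<bullet> \<pi> y"
    using y by (metis power2_norm_eq_inner)
  also have "\<dots> = (\<Sum>b\<in>B. (y \<bullet> b)\<^sup>2)"
    by (simp add: \<pi>_def inner_sum_right power2_eq_square)
  also have "\<dots> = (\<Sum>i\<in>I'. (y \<bullet> h i)\<^sup>2)"
    by (rule sum.reindex_bij_betw[OF h, symmetric])
  finally have ny: "(norm y)\<^sup>2 = (\<Sum>i\<in>I'. (y \<bullet> h i)\<^sup>2)" .
  have "(\<Sum>i\<in>I. (X w i)\<^sup>2) = r\<^sup>2 + (\<Sum>i\<in>I'. (y \<bullet> h i)\<^sup>2)"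
    unfolding I'(1) using I'(2) finI'
    by (simp add: X_def yr) (intro sum.cong, auto)
  also have "\<dots> = (norm w)\<^sup>2"
    by (simp add: yr norm_Pair ny sum_nonneg)
  finally have "(\<Sum>i\<in>I. (X w i)\<^sup>2) = 1"
    using w(1) by simp
  moreover have "g (X w) = 0"
    using g y by simp
  ultimately show thesis
    by (rule that)
qed

subsection \<open>Colorful intersections\<close>

text \<open>As \<open>x j0\<close> is nonzero, the dependence expresses \<open>z j0\<close> as an
  affine combination of the other \<open>k + 1\<close> points. These span a flat of dimension at
  most \<open>k\<close>, which is enlarged inside \<open>V\<close> to dimension exactly
  \<open>k\<close>.\<close>

lemma affinely_dependent_family_in_flat:
  fixes V :: "'a::euclidean_space set" and z :: "nat \<Rightarrow> 'a"
  assumes V: "subspace V" "k \<le> dim V" and zV: "\<And>j. j < k + 2 \<Longrightarrow> z j \<in> V"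
    and x: "(\<Sum>j<k + 2. x j) = 0" "(\<Sum>j<k + 2. x j *\<^sub>R z j) = 0"
    and j0: "j0 < k + 2" "x j0 \<noteq> 0"
  obtains L where "L \<subseteq> V" "affine L" "aff_dim L = int k" "\<And>j. j < k + 2 \<Longrightarrow> z j \<in> L"
proof -
  define j1 where "j1 = (if j0 = 0 then 1 else 0 :: nat)"
  have j1: "j1 < k + 2" "j1 \<noteq> j0"
    by (auto simp: j1_def)
  define S where "S = (\<lambda>j. z j - z j1) ` ({..<k + 2} - {j0, j1})"
  have "card ({..<k + 2} - {j0, j1}) = k"
    using j0 j1 by (simp add: card_Diff_subset)
  then have cardS: "card S \<le> k"
    unfolding S_def by (metis card_image_le finite_Diff finite_lessThan)
  have SV: "S \<subseteq> V"
    using zV j1 subspace_diff[OF V(1)] by (auto simp: S_def)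
  obtain B0 where B0: "B0 \<subseteq> S" "independent B0" "S \<subseteq> span B0"
    using maximal_independent_subset by metis
  obtain B where B: "B0 \<subseteq> B" "B \<subseteq> V" "independent B" "V \<subseteq> span B"
    using maximal_independent_subset_extend[of B0 V] B0 SV by (metis subset_trans)
  have finB: "finite B"
    using B(3) independent_imp_finite by blast
  have "finite S"
    by (simp add: S_def)
  then have "card B0 \<le> k"
    using cardS B0(1) card_mono order_trans by blast
  moreover have "k \<le> card B"
    using V(2) basis_card_eq_dim[OF B(2) B(4) B(3)] by simp
  \<comment> \<open>Choosing \<open>B'\<close> between a basis of the span of \<open>S\<close> and a
    basis of \<open>V\<close> gives exactly \<open>k\<close> directions without leaving
    \<open>V\<close>.\<close>
  ultimately obtain B' where B': "B0 \<subseteq> B'" "B' \<subseteq> B" "card B' = k"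
    using exists_subset_between[OF _ _ B(1) finB] by blast
  define W where "W = span B'"
  have W: "subspace W"
    by (simp add: W_def)
  have "independent B'"
    using B(3) B'(2) independent_mono by blast
  then have dimW: "dim W = k"
    by (simp add: W_def dim_eq_card_independent B'(3))
  have WV: "W \<subseteq> V"
    unfolding W_def using V(1) B(2) B'(2) by (intro span_minimal) auto
  have SW: "S \<subseteq> W"
    using B0(3) span_mono[OF B'(1)] by (auto simp: W_def)
  have zW: "z j - z j1 \<in> W" if "j < k + 2" "j \<noteq> j0" for j
  proof (cases "j = j1")
    case True
    then show ?thesis
      using W by (simp add: subspace_0)
  next
    case False
    then have "z j - z j1 \<in> S"
      using that by (simp add: S_def)
    then show ?thesis
      using SW by blast
  qed
  have "(\<Sum>j<k + 2. x j *\<^sub>R (z j - z j1)) = (\<Sum>j<k + 2. x j *\<^sub>R z j) - (\<Sum>j<k + 2. x j) *\<^sub>R z j1"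
    by (simp only: scaleR_diff_right sum_subtractf scaleR_left.sum)
  then have "(\<Sum>j<k + 2. x j *\<^sub>R (z j - z j1)) = 0"
    using x by simp
  then have "x j0 *\<^sub>R (z j0 - z j1) = - (\<Sum>j\<in>{..<k + 2} - {j0}. x j *\<^sub>R (z j - z j1))"
    using j0(1) by (simp add: sum.remove[of _ j0] add_eq_0_iff2 del: lessThan_Suc sum.lessThan_Suc)
  also have "\<dots> \<in> W"
    using zW by (intro subspace_neg subspace_sum subspace_scale W) auto
  finally have "inverse (x j0) *\<^sub>R x j0 *\<^sub>R (z j0 - z j1) \<in> W"
    by (rule subspace_scale[OF W])
  then have zW': "z j - z j1 \<in> W" if "j < k + 2" for j
    using that zW j0(2) by (cases "j = j0") auto
  show thesis
  proof
    show "(+) (z j1) ` W \<subseteq> V"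
      using zV[OF j1(1)] WV subspace_add[OF V(1)] by auto
    show "affine ((+) (z j1) ` W)"
      using subspace_imp_affine[OF W] affine_translation by blast
    show "aff_dim ((+) (z j1) ` W) = int k"
      by (simp add: aff_dim_translation_eq aff_dim_subspace[OF W] dimW)
    show "z j \<in> (+) (z j1) ` W" if "j < k + 2" for j
      using zW'[OF that] by (intro image_eqI[of _ _ "z j - z j1"]) auto
  qed
qed

text \<open>Grouping the terms by \<open>j = J i0\<close> leaves inner sums of points of
  \<open>C j\<close> with total weight \<open>P\<close>. Normalized by \<open>P\<close>, they are
  convex combinations and stay in \<open>C j\<close>.\<close>

lemma multilinear_slice:
  fixes p :: "('i \<Rightarrow> 'j) \<Rightarrow> 'a::real_vector" and t :: "'i \<Rightarrow> 'j \<Rightarrow> real"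
  assumes I: "finite I" "i0 \<in> I" and A: "\<And>i. i \<in> I \<Longrightarrow> finite (A i)"
    and C: "\<And>j. j \<in> A i0 \<Longrightarrow> convex (C j)" and p: "\<And>J. J \<in> Pi\<^sub>E I A \<Longrightarrow> p J \<in> C (J i0)"
    and t: "\<And>i j. i \<in> I \<Longrightarrow> j \<in> A i \<Longrightarrow> t i j \<ge> 0"
    and P: "P = (\<Prod>i\<in>I - {i0}. \<Sum>j\<in>A i. t i j)" "P \<noteq> 0"
  obtains y where "\<And>j. j \<in> A i0 \<Longrightarrow> y j \<in> C j"
    "(\<Sum>J\<in>Pi\<^sub>E I A. (\<Prod>i\<in>I. t i (J i)) *\<^sub>R p J) = P *\<^sub>R (\<Sum>j\<in>A i0. t i0 j *\<^sub>R y j)"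
proof -
  define I' where "I' = I - {i0}"
  have I': "I = insert i0 I'" "i0 \<notin> I'" "finite I'"
    using I by (auto simp: I'_def)
  define c where "c = (\<lambda>J. \<Prod>i\<in>I'. t i (J i))"
  define y where "y = (\<lambda>j. \<Sum>J\<in>Pi\<^sub>E I' A. (c J / P) *\<^sub>R p (J(i0 := j)))"
  have fin: "finite (Pi\<^sub>E I' A)"
    using I' A by (intro finite_PiE) auto
  have c: "(\<Sum>J\<in>Pi\<^sub>E I' A. c J) = P"
    unfolding c_def P I'_def[symmetric] using I' A by (intro prod_sum_PiE[symmetric]) auto
  have c0: "c J \<ge> 0" if "J \<in> Pi\<^sub>E I' A" for J
    unfolding c_def using that t I'(1) by (intro prod_nonneg) (auto simp: PiE_iff)
  then have "P \<ge> 0"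
    unfolding c[symmetric] by (intro sum_nonneg)
  show thesis
  proof
    fix j assume j: "j \<in> A i0"
    show "y j \<in> C j"
      unfolding y_def
    proof (rule convex_sum[OF fin C[OF j]])
      show "(\<Sum>J\<in>Pi\<^sub>E I' A. c J / P) = 1"
        using P(2) by (simp add: c flip: sum_divide_distrib)
    next
      fix J assume J: "J \<in> Pi\<^sub>E I' A"
      then show "c J / P \<ge> 0"
        using c0 \<open>P \<ge> 0\<close> by simp
      have "J(i0 := j) \<in> Pi\<^sub>E I A"
        unfolding I'(1) PiE_insert_eq using J j by force
      from p[OF this] show "p (J(i0 := j)) \<in> C j"
        by simp
    qed
  next
    have inj: "inj_on (\<lambda>(j, J). J(i0 := j)) (A i0 \<times> Pi\<^sub>E I' A)"
      using I'(2) by (rule inj_combinator)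
    have "(\<Sum>J\<in>Pi\<^sub>E I A. (\<Prod>i\<in>I. t i (J i)) *\<^sub>R p J)
      = (\<Sum>(j, J)\<in>A i0 \<times> Pi\<^sub>E I' A. (\<Prod>i\<in>I. t i ((J(i0 := j)) i)) *\<^sub>R p (J(i0 := j)))"
      unfolding I'(1) PiE_insert_eq by (subst sum.reindex[OF inj]) (simp add: case_prod_unfold)
    also have "\<dots> = (\<Sum>j\<in>A i0. \<Sum>J\<in>Pi\<^sub>E I' A. (\<Prod>i\<in>I. t i ((J(i0 := j)) i)) *\<^sub>R p (J(i0 := j)))"
      by (rule sum.cartesian_product[symmetric])
    also have "\<dots> = (\<Sum>j\<in>A i0. \<Sum>J\<in>Pi\<^sub>E I' A. (P * t i0 j) *\<^sub>R (c J / P) *\<^sub>R p (J(i0 := j)))"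
    proof (intro sum.cong refl)
      fix j J
      have "(\<Prod>i\<in>I'. t i ((J(i0 := j)) i)) = c J"
        unfolding c_def using I'(2) by (intro prod.cong) auto
      then have "(\<Prod>i\<in>I. t i ((J(i0 := j)) i)) = t i0 j * c J"
        using I' by simp
      then show "(\<Prod>i\<in>I. t i ((J(i0 := j)) i)) *\<^sub>R p (J(i0 := j))
        = (P * t i0 j) *\<^sub>R (c J / P) *\<^sub>R p (J(i0 := j))"
        using P(2) by simp
    qed
    also have "\<dots> = P *\<^sub>R (\<Sum>j\<in>A i0. t i0 j *\<^sub>R y j)"
      by (simp add: y_def scaleR_right.sum)
    finally show "(\<Sum>J\<in>Pi\<^sub>E I A. (\<Prod>i\<in>I. t i (J i)) *\<^sub>R p J) = P *\<^sub>R (\<Sum>j\<in>A i0. t i0 j *\<^sub>R y j)" .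
  qed
qed

(* The ambient space is an arbitrary linear subspace V of dimension n + m - 1 (V = UNIV is
   allowed) rather than a whole Euclidean type, since DIM('a) > 0 would exclude n = 1, m = 0.
   The i-th family is indexed by j < k i + 2, so repeated members are allowed. *)

theorem theorem1:
  fixes n m :: nat and k :: "nat \<Rightarrow> nat"
    and V :: "'a::euclidean_space set"
    and F :: "nat \<Rightarrow> nat \<Rightarrow> 'a set"
  assumes "n \<ge> 1"
    and "m = (\<Sum>i\<in>{1..n}. k i)"
    and "subspace V" and "dim V = n + m - 1"
    and "\<And>i j. i \<in> {1..n} \<Longrightarrow> j < k i + 2 \<Longrightarrow> convex (F i j) \<and> F i j \<subseteq> V"
    and "colorful_intersection n (\<lambda>i. F i ` {..<k i + 2})"
  shows "\<exists>i\<in>{1..n}. \<exists>L\<subseteq>V. transversal (k i) (F i ` {..<k i + 2}) L"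
proof -
  define I where "I = {1..n}"
  define A where "A = (\<lambda>i. {..<k i + 2})"
  have FV: "F i j \<subseteq> V" and Fconv: "convex (F i j)" if "i \<in> I" "j \<in> A i" for i j
    using assms(5) that by (auto simp: I_def A_def)
  have "\<exists>v. \<forall>i\<in>I. v \<in> F i (J i)" if "J \<in> Pi\<^sub>E I A" for J
  proof -
    have "\<forall>i\<in>{1..n}. F i (J i) \<in> F i ` {..<k i + 2}"
      using that by (auto simp: I_def A_def PiE_iff)
    then have "(\<Inter>i\<in>{1..n}. F i (J i)) \<noteq> {}"
      using assms(6)[unfolded colorful_intersection_def, THEN spec[of _ "\<lambda>i. F i (J i)"]] by (rule rev_mp)
    then show ?thesis
      by (auto simp: I_def)
  qed
  then obtain p where p: "\<And>J i. J \<in> Pi\<^sub>E I A \<Longrightarrow> i \<in> I \<Longrightarrow> p J \<in> F i (J i)"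
    by metis
  have finI: "finite I" and finA: "\<And>i. finite (A i)"
    by (auto simp: I_def A_def)

  define E where "E = (SIGMA i:I. {..<k i + 1})"
  have finE: "finite E"
    by (simp add: E_def finI)
  \<comment> \<open>The count is \<open>m + n\<close>, one more than the dimension of
    \<open>V\<close>, as Borsuk-Ulam requires.\<close>
  have cardE: "card E = Suc (dim V)"
    using assms(1,2,4) by (simp add: E_def finI sum.distrib I_def del: One_nat_def)
  \<comment> \<open>A vector \<open>x\<close> indexed by \<open>E\<close> encodes \<open>\<xi> x i \<in> \<real>\<^bsup>k i + 2\<^esup>\<close> with coordinate sum \<open>0\<close>. The factor \<open>card E\<close>
    ensures that, for \<open>x\<close> on the unit sphere, the positive part of some \<open>\<xi> x i\<close> has sum \<open>\<mu> x i \<ge> 1\<close>;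
    then the correction term in \<open>t\<close> vanishes and \<open>t x i\<close>, \<open>t (- x) i\<close> have disjoint supports.\<close>
  define \<xi> :: "(nat \<times> nat \<Rightarrow> real) \<Rightarrow> nat \<Rightarrow> nat \<Rightarrow> real" where
    "\<xi> = (\<lambda>x i j. real (card E) * (if j < k i + 1 then x (i, j) else - (\<Sum>l<k i + 1. x (i, l))))"
  define \<mu> where "\<mu> = (\<lambda>x i. \<Sum>j\<in>A i. max 0 (\<xi> x i j))"
  define t where "t = (\<lambda>x i j. max 0 (\<xi> x i j) + (if j = 0 then max 0 (1 - \<mu> x i) else 0))"
  define M where "M = (\<lambda>x. \<Sum>J\<in>Pi\<^sub>E I A. (\<Prod>i\<in>I. t x i (J i)) *\<^sub>R p J)"
  define g where "g = (\<lambda>x. M x - M (\<lambda>e. - x e))"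

  have \<xi>_sum: "(\<Sum>j\<in>A i. \<xi> x i j) = 0" for x i
  proof -
    have "A i = insert (k i + 1) {..<k i + 1}"
      by (auto simp: A_def)
    then show ?thesis
      by (simp add: \<xi>_def sum_distrib_left[symmetric] del: lessThan_Suc sum.lessThan_Suc)
  qed
  have \<xi>_uminus: "\<xi> (\<lambda>e. - x e) i j = - \<xi> x i j" for x i j
    by (simp add: \<xi>_def sum_negf del: sum.lessThan_Suc)
  have max_diff: "max 0 a - max 0 (- a) = a" for a :: real
    by (simp add: max_def)
  \<comment> \<open>The coordinates \<open>\<xi> x i j\<close> sum to 0 over \<open>j\<close>, so
    their positive and negative parts have equal totals.\<close>
  have \<mu>_uminus: "\<mu> (\<lambda>e. - x e) i = \<mu> x i" for x i
  proof -
    have "\<mu> x i - \<mu> (\<lambda>e. - x e) i = 0"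
      unfolding \<mu>_def \<xi>_uminus sum_subtractf[symmetric] max_diff by (rule \<xi>_sum)
    then show ?thesis
      by simp
  qed
  have t_nonneg: "t x i j \<ge> 0" for x i j
    by (simp add: t_def)
  \<comment> \<open>The correction at vertex 0 lifts the total weight to at least 1. Hence the
    weights need no normalization to the simplex: totals are positive and agree at antipodal
    points.\<close>
  have t_sum: "(\<Sum>j\<in>A i. t x i j) = max 1 (\<mu> x i)" for x i
  proof -
    have zeroA: "0 \<in> A i"
      by (simp add: A_def)
    have "(\<Sum>j\<in>A i. t x i j) = \<mu> x i + max 0 (1 - \<mu> x i)"
      using finA[of i] by (simp add: t_def \<mu>_def sum.distrib zeroA)
    then show ?thesis
      by (simp add: max_def)
  qed

  have pV: "p J \<in> V" if "J \<in> Pi\<^sub>E I A" for J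
  proof -
    have "1 \<in> I"
      using assms(1) by (simp add: I_def)
    then show ?thesis
      using p[OF that] FV that by (auto simp: PiE_iff)
  qed
  have MV: "M x \<in> V" for x
    unfolding M_def by (intro subspace_sum subspace_scale assms(3) pV)
  have cont\<xi>: "continuous_on UNIV (\<lambda>x. \<xi> x i j)" for i j
    unfolding \<xi>_def by (cases "j < k i + 1") (auto intro!: continuous_intros)
  have "continuous_on UNIV (\<lambda>x. \<mu> x i)" for i
    unfolding \<mu>_def by (intro continuous_intros cont\<xi>)
  then have contt: "continuous_on UNIV (\<lambda>x. t x i j)" for i j
    unfolding t_def by (cases "j = 0") (auto intro!: continuous_intros cont\<xi>)
  have contM: "continuous_on UNIV M"
    unfolding M_def by (intro continuous_intros contt)
  have "continuous_on UNIV (\<lambda>x e. - x e :: real)"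
    by (intro continuous_on_coordinatewise_then_product continuous_intros continuous_on_product_coordinates)
  then have "continuous_on UNIV (\<lambda>x. M (\<lambda>e. - x e))"
    by (rule continuous_on_compose2[OF contM]) auto
  then have contg: "continuous_on UNIV g"
    unfolding g_def by (intro continuous_intros contM)
  have gV: "g x \<in> V" for x
    unfolding g_def by (intro subspace_diff assms(3) MV)
  have "g (\<lambda>e. - x e) = - g x" for x
    by (simp add: g_def)
  then obtain x where x: "(\<Sum>e\<in>E. (x e)\<^sup>2) = 1" "g x = 0"
    using Borsuk_Ulam_coordinates[OF assms(3) finE cardE contg gV] by blast
  define x' where "x' = (\<lambda>e. - x e)"

  \<comment> \<open>Otherwise each square would be below \<open>1 / card E\<close>, and the squares
    could not sum to 1.\<close>
  have "\<exists>e\<in>E. 1 \<le> real (card E) * \<bar>x e\<bar>"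
  proof (rule ccontr)
    assume "\<not> ?thesis"
    then have small: "real (card E) * \<bar>x e\<bar> < 1" if "e \<in> E" for e
      using that by force
    have "E \<noteq> {}" "card E \<ge> 1"
      using cardE by auto
    have "(\<Sum>e\<in>E. (x e)\<^sup>2) < (\<Sum>e\<in>E. 1 / real (card E))"
    proof (rule sum_strict_mono[OF finE \<open>E \<noteq> {}\<close>])
      fix e assume "e \<in> E"
      have "1 * \<bar>x e\<bar> \<le> real (card E) * \<bar>x e\<bar>"
        using \<open>card E \<ge> 1\<close> by (intro mult_right_mono) auto
      then have "\<bar>x e\<bar> \<le> 1"
        using small[OF \<open>e \<in> E\<close>] by simp
      then have "(x e)\<^sup>2 \<le> \<bar>x e\<bar>"
        using mult_left_le[of "\<bar>x e\<bar>" "\<bar>x e\<bar>"] by (simp add: power2_eq_square)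
      also have "\<dots> < 1 / real (card E)"
        using small[OF \<open>e \<in> E\<close>] \<open>card E \<ge> 1\<close> by (simp add: field_simps)
      finally show "(x e)\<^sup>2 < 1 / real (card E)" .
    qed
    then show False
      using x(1) \<open>card E \<ge> 1\<close> by simp
  qed
  then obtain i l where i: "i \<in> I" and l: "l < k i + 1" "1 \<le> real (card E) * \<bar>x (i, l)\<bar>"
    by (auto simp: E_def)
  have lA: "l \<in> A i"
    using l by (simp add: A_def)
  have \<mu>_ge: "max 0 (\<xi> y i l) \<le> \<mu> y i" for y
    unfolding \<mu>_def using lA finA by (intro member_le_sum) auto
  have "\<bar>\<xi> x i l\<bar> \<ge> 1"
    using l by (simp add: \<xi>_def abs_mult)
  \<comment> \<open>Depending on its sign, \<open>\<xi> x i l\<close> contributes at least 1 to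
    \<open>\<mu>\<close> at \<open>x\<close> or at the antipode, and the two values
    coincide.\<close>
  then have \<mu>: "\<mu> x i \<ge> 1"
    using \<mu>_ge[of x] \<mu>_ge[of "\<lambda>e. - x e"] by (simp add: \<xi>_uminus \<mu>_uminus) linarith
  then have tx: "t x i j = max 0 (\<xi> x i j)" and tx': "t x' i j = max 0 (- \<xi> x i j)" for j
    by (simp_all add: t_def x'_def \<xi>_uminus \<mu>_uminus)

  define P where "P = (\<Prod>i\<in>I - {i}. max 1 (\<mu> x i))"
  have "P > 0"
    unfolding P_def by (intro prod_pos) auto
  then have Pnz: "P \<noteq> 0"
    by simp
  have P: "P = (\<Prod>i\<in>I - {i}. \<Sum>j\<in>A i. t x i j)" "P = (\<Prod>i\<in>I - {i}. \<Sum>j\<in>A i. t x' i j)"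
    by (simp_all add: P_def t_sum x'_def \<mu>_uminus)
  have M_eq: "M x = (\<Sum>J\<in>Pi\<^sub>E I A. (\<Prod>i\<in>I. t x i (J i)) *\<^sub>R p J)" for x
    by (simp add: M_def)
  obtain y where y: "\<And>j. j \<in> A i \<Longrightarrow> y j \<in> F i j" "M x = P *\<^sub>R (\<Sum>j\<in>A i. t x i j *\<^sub>R y j)"
    by (rule multilinear_slice[where C = "F i" and p = p and t = "t x",
          OF finI i finA Fconv[OF i] p[OF _ i] t_nonneg P(1) Pnz, folded M_eq])
      (assumption, assumption, rule that)
  obtain y' where y': "\<And>j. j \<in> A i \<Longrightarrow> y' j \<in> F i j" "M x' = P *\<^sub>R (\<Sum>j\<in>A i. t x' i j *\<^sub>R y' j)"
    by (rule multilinear_slice[where C = "F i" and p = p and t = "t x'",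
          OF finI i finA Fconv[OF i] p[OF _ i] t_nonneg P(2) Pnz, folded M_eq])
      (assumption, assumption, rule that)
  \<comment> \<open>The weights at \<open>x\<close> and \<open>x'\<close> are the positive and
    negative parts of \<open>\<xi> x i j\<close>, so for each \<open>j\<close> at most one of
    \<open>y j\<close> and \<open>y' j\<close> counts. Selecting it merges the two slices into one
    dependence with coefficients \<open>\<xi> x i j\<close>.\<close>
  define z where "z = (\<lambda>j. if \<xi> x i j \<ge> 0 then y j else y' j)"
  have zF: "z j \<in> F i j" if "j \<in> A i" for j
    using that y(1) y'(1) by (simp add: z_def)
  have "M x = M x'"
    using x(2) by (simp add: g_def x'_def)
  then have "(\<Sum>j\<in>A i. t x i j *\<^sub>R y j) = (\<Sum>j\<in>A i. t x' i j *\<^sub>R y' j)"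
    using y(2) y'(2) \<open>P > 0\<close> by simp
  then have "(\<Sum>j\<in>A i. t x i j *\<^sub>R y j - t x' i j *\<^sub>R y' j) = 0"
    by (simp add: sum_subtractf)
  moreover have "t x i j *\<^sub>R y j - t x' i j *\<^sub>R y' j = \<xi> x i j *\<^sub>R z j" for j
    by (simp add: tx tx' z_def max_def)
  ultimately have \<xi>z: "(\<Sum>j<k i + 2. \<xi> x i j *\<^sub>R z j) = 0"
    by (simp add: A_def)
  \<comment> \<open>Since \<open>n \<ge> 1\<close>, the dimension of \<open>V\<close> is at least
    \<open>m\<close>, so there is room in \<open>V\<close> for a flat of dimension
    \<open>k i\<close>.\<close>
  have "(\<Sum>i\<in>I. k i) \<ge> k i"
    using i finI by (intro member_le_sum) auto
  then have "k i \<le> dim V"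
    using assms(1,2,4) by (simp add: I_def)
  then obtain L where "L \<subseteq> V" "affine L" "aff_dim L = int (k i)" "\<And>j. j < k i + 2 \<Longrightarrow> z j \<in> L"
  proof (rule affinely_dependent_family_in_flat[OF assms(3) _ _ _ \<xi>z, of l])
    show "z j \<in> V" if "j < k i + 2" for j
      using zF[of j] FV[OF i, of j] that by (auto simp: A_def)
    show "(\<Sum>j<k i + 2. \<xi> x i j) = 0"
      using \<xi>_sum[of x i] by (simp add: A_def)
    show "l < k i + 2" "\<xi> x i l \<noteq> 0"
      using l(1) \<open>\<bar>\<xi> x i l\<bar> \<ge> 1\<close> by auto
  qed (rule that)
  then have "L \<subseteq> V" "transversal (k i) (F i ` {..<k i + 2}) L"
    using zF by (auto simp: transversal_def A_def)
  then show ?thesis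
    using i unfolding I_def by blast
qed

end
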